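(* Let $p_\lambda:[0,\infty)\to\mathbb{R}$ be a concave differentiable penalty function with finite right derivative at $0$. For $t_0\ge 0$ let $\psi^*(t)=p_\lambda(t_0)+p_\lambda'(t_0)(t-t_0)$, $t\ge 0$, be the local linear approximation of $p_\lambda$ at $t_0$. Suppose that $\psi:[0,\infty)\to\mathbb{R}$ is a convex majorization function of $p_\lambda$ at $t_0$, that is, $\psi$ is convex, $\psi(t_0)=p_\lambda(t_0)$, and $\psi(t)\ge p_\lambda(t)$ for all $t\ge 0$. Then $\psi(t)\ge\psi^*(t)$ for all $t\ge 0$. If instead the right derivative of $p_\lambda$ at zero diverges ($p_\lambda$ being differentiable on $(0,\infty)$), the same conclusion holds for every $t_0>0$ and all $t\ge 0$.
   Context: $p_\lambda'(0)$ denotes the right derivative of $p_\lambda$ at $0$; $\lambda$ is a fixed regularization parameter. *)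

theory Defs
  imports "HOL-Analysis.Analysis"
begin

text \<open>
  Functions on the half-line are represented by total functions of which only the values on
  \<open>{0..}\<close> are used.  Derivatives are taken within \<open>{0..}\<close>, so that this is the ordinary
  derivative at \<open>t\<^sub>0 > 0\<close> and the right derivative at \<open>t\<^sub>0 = 0\<close>.
\<close>

definition local_linear_approx :: "(real \<Rightarrow> real) \<Rightarrow> real \<Rightarrow> real \<Rightarrow> real" where
  "local_linear_approx p t\<^sub>0 t = p t\<^sub>0 + vector_derivative p (at t\<^sub>0 within {0..}) * (t - t\<^sub>0)"

definition convex_majorization :: "(real \<Rightarrow> real) \<Rightarrow> real \<Rightarrow> (real \<Rightarrow> real) \<Rightarrow> bool" where
  "convex_majorization p t\<^sub>0 \<psi> \<longleftrightarrow>
     convex_on {0..} \<psi> \<and> \<psi> t\<^sub>0 = p t\<^sub>0 \<and> (\<forall>t\<ge>0. p t \<le> \<psi> t)"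

text \<open>
  Divergence means that the one-sided difference quotients have no finite limit.  For a function
  concave on \<open>{0..}\<close> they are monotone, so at \<open>0\<close> this says that they tend to infinity.
\<close>

definition right_derivative_diverges :: "(real \<Rightarrow> real) \<Rightarrow> real \<Rightarrow> bool" where
  "right_derivative_diverges p a \<longleftrightarrow>
     \<not> (\<exists>L. ((\<lambda>t. (p t - p a) / (t - a)) \<longlongrightarrow> L) (at_right a))"

end

theory Submission
  imports Defs
begin

text \<open>
  Along the segment from the touching point \<open>a\<close> to a point \<open>x\<close>, the convex majorant lies below its
  chord and above the majorized function.  Since both functions agree at \<open>a\<close>, every difference
  quotient of the majorized function along the segment is at most the slope of that chord.
  Letting the step tend to \<open>0\<close> from the right turns the difference quotient into the directional
  derivative, which is the slope of the tangent.  The step only moves from \<open>a\<close> towards \<open>x\<close>, so the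
  boundary point \<open>t\<^sub>0 = 0\<close> of the half-line is covered by the same argument as the interior points
  (\<open>tangent_le_convex_majorant\<close>).
\<close>

text \<open>
  Restricting to a segment reduces the claim to one real variable, the step \<open>s \<in> {0..1}\<close>.  The
  derivative within \<open>S\<close> is enough, because convexity keeps the whole segment inside \<open>S\<close>.
\<close>

lemma tangent_le_convex_majorant:
  fixes f \<psi> :: "'a::real_normed_vector \<Rightarrow> real"
  assumes conv: "convex_on S \<psi>"
    and deriv: "(f has_derivative D) (at a within S)"
    and touch: "\<psi> a = f a"
    and major: "\<And>y. y \<in> S \<Longrightarrow> f y \<le> \<psi> y"
    and aS: "a \<in> S" and xS: "x \<in> S"
  shows "f a + D (x - a) \<le> \<psi> x"
proof -
  let ?\<gamma> = "\<lambda>s::real. a + s *\<^sub>R (x - a)"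
  have seg: "?\<gamma> s = (1 - s) *\<^sub>R a + s *\<^sub>R x" for s
    by (simp add: algebra_simps)
  have inS: "?\<gamma> s \<in> S" if "s \<in> {0..1}" for s
    using convexD_alt[OF convex_on_imp_convex[OF conv] aS xS, of s] that by (simp add: seg)
  have quotient_le: "(f (?\<gamma> s) - f a) / s \<le> \<psi> x - f a" if "0 < s" "s \<le> 1" for s
  proof -
    have "f (?\<gamma> s) \<le> \<psi> (?\<gamma> s)"
      using inS major that by simp
    also have "\<dots> \<le> (1 - s) * \<psi> a + s * \<psi> x"
      unfolding seg using convex_onD[OF conv, of s a x] aS xS that by simp
    finally have "f (?\<gamma> s) - f a \<le> s * (\<psi> x - f a)"
      by (simp add: touch algebra_simps)
    then show ?thesis
      using that by (simp add: pos_divide_le_eq mult.commute)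
  qed
  have "(?\<gamma> has_derivative (\<lambda>s. s *\<^sub>R (x - a))) (at 0 within {0..1})"
    by (auto intro!: derivative_eq_intros)
  moreover have "(f has_derivative D) (at (?\<gamma> 0) within ?\<gamma> ` {0..1})"
    using has_derivative_subset[OF deriv] inS by (simp add: image_subset_iff)
  ultimately have "((f \<circ> ?\<gamma>) has_derivative (D \<circ> (\<lambda>s. s *\<^sub>R (x - a)))) (at 0 within {0..1})"
    by (rule diff_chain_within)
  moreover have "D \<circ> (\<lambda>s. s *\<^sub>R (x - a)) = (*) (D (x - a))"
    using linear_scale[OF has_derivative_linear[OF deriv]] by (auto simp: mult.commute)
  ultimately have "((f \<circ> ?\<gamma>) has_field_derivative D (x - a)) (at 0 within {0..1})"
    by (simp only: has_field_derivative_def)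
  then have lim: "((\<lambda>s. (f (?\<gamma> s) - f a) / s) \<longlongrightarrow> D (x - a)) (at 0 within {0..1})"
    by (simp add: has_field_derivative_iff)
  have "D (x - a) \<le> \<psi> x - f a"
  proof (rule tendsto_upperbound[OF lim])
    show "\<forall>\<^sub>F s in at 0 within {0..1}. (f (?\<gamma> s) - f a) / s \<le> \<psi> x - f a"
      using quotient_le by (simp add: eventually_at_filter)
    show "at 0 within {0..1::real} \<noteq> bot"
      by (simp add: at_within_Icc_at_right)
  qed
  then show ?thesis by simp
qed

lemma local_linear_approx_le_convex_majorization:
  assumes "convex_majorization p t\<^sub>0 \<psi>" "p differentiable (at t\<^sub>0 within {0..})" "0 \<le> t\<^sub>0" "0 \<le> t"
  shows "local_linear_approx p t\<^sub>0 t \<le> \<psi> t"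
proof -
  have "(p has_derivative (\<lambda>h. h *\<^sub>R vector_derivative p (at t\<^sub>0 within {0..}))) (at t\<^sub>0 within {0..})"
    using assms(2) by (simp add: vector_derivative_works has_vector_derivative_def)
  from tangent_le_convex_majorant[OF _ this, of \<psi> t] show ?thesis
    using assms(1,3,4) by (simp add: convex_majorization_def local_linear_approx_def mult.commute)
qed

theorem theorem2:
  fixes p :: "real \<Rightarrow> real"
  assumes "concave_on {0..} p"
  shows "(p differentiable_on {0..} \<longrightarrow>
            (\<forall>t\<^sub>0\<ge>0. \<forall>\<psi>. convex_majorization p t\<^sub>0 \<psi> \<longrightarrow>
              (\<forall>t\<ge>0. \<psi> t \<ge> local_linear_approx p t\<^sub>0 t)))
       \<and> (p differentiable_on {0<..} \<and> right_derivative_diverges p 0 \<longrightarrow>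
            (\<forall>t\<^sub>0>0. \<forall>\<psi>. convex_majorization p t\<^sub>0 \<psi> \<longrightarrow>
              (\<forall>t\<ge>0. \<psi> t \<ge> local_linear_approx p t\<^sub>0 t)))"
proof (intro conjI impI allI)
  fix t\<^sub>0 \<psi> and t :: real
  assume "p differentiable_on {0..}" "0 \<le> t\<^sub>0" "convex_majorization p t\<^sub>0 \<psi>" "0 \<le> t"
  then show "local_linear_approx p t\<^sub>0 t \<le> \<psi> t"
    by (simp add: local_linear_approx_le_convex_majorization differentiable_on_def)
next
  fix t\<^sub>0 \<psi> and t :: real
  assume diff: "p differentiable_on {0<..} \<and> right_derivative_diverges p 0"
    and t\<^sub>0: "0 < t\<^sub>0" and "convex_majorization p t\<^sub>0 \<psi>" "0 \<le> t"
  \<comment> \<open>An interior point of the half-line has a two-sided derivative, which is also the derivative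
    within the closed half-line.\<close>
  have "p differentiable (at t\<^sub>0)"
    using diff t\<^sub>0 by (simp add: differentiable_on_eq_differentiable_at)
  then have "p differentiable (at t\<^sub>0 within {0..})"
    by (rule differentiable_at_withinI)
  with \<open>convex_majorization p t\<^sub>0 \<psi>\<close> t\<^sub>0 \<open>0 \<le> t\<close> show "local_linear_approx p t\<^sub>0 t \<le> \<psi> t"
    by (simp add: local_linear_approx_le_convex_majorization)
qed

end
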